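(* Let $n\ge1$ and $\lceil n/2\rceil\le k\le n$. Then: (i) the degree of the polynomial $LB_{n,k}(123)$ is $\dfrac{(4n+1)k-3k^{2}-n^{2}-n}{2}$; (ii) the leading coefficient of $LB_{n,k}(123)$ is $(n-k)!$.
   Context: A set partition $\pi=B_1/B_2/\cdots/B_k$ of $[n]=\{1,\dots,n\}$ is written with its blocks ordered so that $\min B_1<\min B_2<\cdots<\min B_k$. For $S\subseteq[n]$, restrict $\pi$ to $S$ by taking the nonempty intersections $B_i\cap S$, and standardize by replacing the smallest element of $S$ by $1$, the second smallest by $2$, etc. The partition $\pi$ contains a partition $\omega$ if the standardized restriction to some $S$ equals $\omega$; otherwise $\pi$ avoids $\omega$. $\Pi_{n,k}(\omega)$ is the set of partitions of $[n]$ with exactly $k$ blocks that avoid $\omega$. Here $123$ denotes the one-block partition $\{\{1,2,3\}\}$ of $[3]$. The restricted growth function (RGF) of $\pi$ is the word $w(\pi)=a_1\cdots a_n$ with $a_i=j$ iff $i\in B_j$. For a word $w=a_1\cdots a_n$ put $lb(a_j)=\#\{a_i: i<j,\ a_i>a_j\}$ (the cardinality of a set of values, so distinct letters are counted once), $lb(w)=\sum_j lb(a_j)$, and $lb(\pi)=lb(w(\pi))$. $LB_{n,k}(\omega)=LB_{n,k}(\omega;q)=\sum_{\pi\in\Pi_{n,k}(\omega)}q^{lb(\pi)}$. *)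

theory Defs
  imports Complex_Main "HOL-Library.Disjoint_Sets" "HOL-Computational_Algebra.Polynomial"
begin

text \<open>A set partition of \<open>[n]\<close> is a \<open>nat set set\<close> satisfying \<open>partition_on {1..n}\<close>.\<close>

definition restriction :: "nat set set \<Rightarrow> nat set \<Rightarrow> nat set set" where
  "restriction \<pi> S = {B \<inter> S | B. B \<in> \<pi> \<and> B \<inter> S \<noteq> {}}"

text \<open>The \<open>i\<close>-th smallest element \<open>x\<close> of \<open>S\<close> has exactly \<open>i\<close> elements of \<open>S\<close> below or equal to it.\<close>

definition standardize :: "nat set \<Rightarrow> nat set set \<Rightarrow> nat set set" where
  "standardize S \<sigma> = (\<lambda>B. (\<lambda>x. card {y \<in> S. y \<le> x}) ` B) ` \<sigma>"

definition contains :: "nat set set \<Rightarrow> nat set set \<Rightarrow> bool" where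
  "contains \<pi> \<omega> \<longleftrightarrow> (\<exists>S. S \<subseteq> \<Union>\<pi> \<and> standardize S (restriction \<pi> S) = \<omega>)"

abbreviation avoids :: "nat set set \<Rightarrow> nat set set \<Rightarrow> bool" where
  "avoids \<pi> \<omega> \<equiv> \<not> contains \<pi> \<omega>"

definition avoiders :: "nat \<Rightarrow> nat \<Rightarrow> nat set set \<Rightarrow> nat set set set" where
  "avoiders n k \<omega> = {\<pi>. partition_on {1..n} \<pi> \<and> card \<pi> = k \<and> avoids \<pi> \<omega>}"

definition blocks :: "nat set set \<Rightarrow> nat set list" where
  "blocks \<pi> = (THE Bs. set Bs = \<pi> \<and> sorted_wrt (\<lambda>B C. Min B < Min C) Bs)"

text \<open>Positions in lists start at 0, whereas blocks and letters are numbered from 1: the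
  block \<open>B\<^sub>j\<close> is \<open>blocks \<pi> ! (j - 1)\<close> and the letter \<open>a\<^sub>i\<close> is \<open>rgf n \<pi> ! (i - 1)\<close>.\<close>

definition rgf :: "nat \<Rightarrow> nat set set \<Rightarrow> nat list" where
  "rgf n \<pi> = map (\<lambda>i. THE j. 1 \<le> j \<and> j \<le> card \<pi> \<and> i \<in> blocks \<pi> ! (j - 1)) [1..<Suc n]"

definition lb_letter :: "nat list \<Rightarrow> nat \<Rightarrow> nat" where
  "lb_letter w j = card {w ! i | i. i < j \<and> w ! i > w ! j}"

definition lb_word :: "nat list \<Rightarrow> nat" where
  "lb_word w = (\<Sum>j<length w. lb_letter w j)"

definition lb :: "nat \<Rightarrow> nat set set \<Rightarrow> nat" where
  "lb n \<pi> = lb_word (rgf n \<pi>)"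

text \<open>\<open>monom 1 m\<close> is \<open>q ^ m\<close>.\<close>

definition LB :: "nat \<Rightarrow> nat \<Rightarrow> nat set set \<Rightarrow> int poly" where
  "LB n k \<omega> = (\<Sum>\<pi>\<in>avoiders n k \<omega>. monom 1 (lb n \<pi>))"

text \<open>The sum and the definite descriptions above are meaningful: the index set is finite, and
  the listing of the blocks and the letters exist and are unique.\<close>

lemma finite_avoiders: "finite (avoiders n k \<omega>)"
proof (rule finite_subset)
  show "avoiders n k \<omega> \<subseteq> Pow (Pow {1..n})"
    by (auto simp: avoiders_def partition_on_def)
qed simp

lemma blocks_ex1:
  fixes \<pi> :: "nat set set"
  assumes "partition_on {1..n} \<pi>"
  shows "\<exists>!Bs. set Bs = \<pi> \<and> sorted_wrt (\<lambda>B C. Min B < Min C) Bs"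
proof -
  have fin: "finite \<pi>"
    by (rule finite_elements[OF _ assms]) simp
  have finB: "finite B" "B \<noteq> {}" if "B \<in> \<pi>" for B
  proof -
    have "B \<subseteq> {1..n}" using partition_onD1[OF assms] that by blast
    then show "finite B" by (rule finite_subset) simp
    show "B \<noteq> {}" using partition_onD3[OF assms] that by metis
  qed
  have inj: "inj_on Min \<pi>"
  proof (rule inj_onI)
    fix B C assume BC: "B \<in> \<pi>" "C \<in> \<pi>" "Min B = Min C"
    have "Min B \<in> B" using finB[OF BC(1)] by (rule Min_in)
    moreover have "Min B \<in> C" unfolding BC(3) using finB[OF BC(2)] by (rule Min_in)
    ultimately have "B \<inter> C \<noteq> {}" by blast
    then show "B = C" using disjointD[OF partition_onD2[OF assms] BC(1,2)] by metis
  qed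
  have iff: "set Bs = \<pi> \<and> sorted_wrt (\<lambda>B C. Min B < Min C) Bs \<longleftrightarrow>
      Bs = map (the_inv_into \<pi> Min) (sorted_list_of_set (Min ` \<pi>))" (is "_ \<longleftrightarrow> Bs = ?L") for Bs
  proof
    assume Bs: "set Bs = \<pi> \<and> sorted_wrt (\<lambda>B C. Min B < Min C) Bs"
    then have "sorted_wrt (<) (map Min Bs)" by (simp add: sorted_wrt_map)
    moreover have "set (map Min Bs) = Min ` \<pi>" using Bs by simp
    ultimately have "map Min Bs = sorted_list_of_set (Min ` \<pi>)"
      by (metis sorted_list_of_set.idem_if_sorted_distinct strict_sorted_iff)
    then have "?L = map (the_inv_into \<pi> Min) (map Min Bs)" by simp
    also have "\<dots> = map (\<lambda>B. B) Bs"
      unfolding map_map by (rule map_cong) (use Bs inj in \<open>auto simp: the_inv_into_f_f\<close>)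
    finally show "Bs = ?L" by simp
  next
    assume Bs: "Bs = ?L"
    have "map Min ?L = map (\<lambda>x. x) (sorted_list_of_set (Min ` \<pi>))"
      unfolding map_map
      by (rule map_cong) (use inj fin in \<open>auto simp: f_the_inv_into_f\<close>)
    then have "sorted_wrt (<) (map Min ?L)" by simp
    moreover have "set ?L = \<pi>" using inj fin by (force simp: the_inv_into_f_f)
    ultimately show "set Bs = \<pi> \<and> sorted_wrt (\<lambda>B C. Min B < Min C) Bs"
      using Bs by (simp add: sorted_wrt_map)
  qed
  show ?thesis unfolding iff by simp
qed

lemma
  assumes "partition_on {1..n} \<pi>"
  shows set_blocks: "set (blocks \<pi>) = \<pi>"
    and sorted_blocks: "sorted_wrt (\<lambda>B C. Min B < Min C) (blocks \<pi>)"
  using theI'[OF blocks_ex1[OF assms]] by (auto simp: blocks_def)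

lemma distinct_blocks:
  assumes "partition_on {1..n} \<pi>"
  shows "distinct (blocks \<pi>)"
proof -
  have "sorted_wrt (<) (map Min (blocks \<pi>))"
    using sorted_blocks[OF assms] by (simp add: sorted_wrt_map)
  then show ?thesis by (metis distinct_map strict_sorted_iff)
qed

lemma letter_ex1:
  assumes "partition_on {1..n} \<pi>" "i \<in> {1..n}"
  shows "\<exists>!j. 1 \<le> j \<and> j \<le> card \<pi> \<and> i \<in> blocks \<pi> ! (j - 1)"
proof -
  have len: "length (blocks \<pi>) = card \<pi>"
    using distinct_card[OF distinct_blocks[OF assms(1)]] set_blocks[OF assms(1)] by simp
  have "i \<in> \<Union>\<pi>"
    using partition_onD1[OF assms(1)] assms(2) by simp
  then obtain B where "B \<in> set (blocks \<pi>)" "i \<in> B"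
    unfolding set_blocks[OF assms(1)] by (rule UnionE)
  then obtain m where m: "m < card \<pi>" "i \<in> blocks \<pi> ! m"
    unfolding in_set_conv_nth len by blast
  show ?thesis
  proof (rule ex1I[of _ "Suc m"])
    show "1 \<le> Suc m \<and> Suc m \<le> card \<pi> \<and> i \<in> blocks \<pi> ! (Suc m - 1)"
      using m by simp
  next
    fix j assume j: "1 \<le> j \<and> j \<le> card \<pi> \<and> i \<in> blocks \<pi> ! (j - 1)"
    then have less: "j - 1 < card \<pi>" by linarith
    have mem: "blocks \<pi> ! r \<in> \<pi>" if "r < card \<pi>" for r
      using nth_mem[of r "blocks \<pi>"] that unfolding len set_blocks[OF assms(1)] .
    have "blocks \<pi> ! (j - 1) \<inter> blocks \<pi> ! m \<noteq> {}"
      using j m(2) by blast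
    then have "blocks \<pi> ! (j - 1) = blocks \<pi> ! m"
      using disjointD[OF partition_onD2[OF assms(1)] mem[OF less] mem[OF m(1)]] by metis
    then have "j - 1 = m"
      using nth_eq_iff_index_eq[OF distinct_blocks[OF assms(1)]] less m(1) unfolding len by metis
    then show "j = Suc m" using j by linarith
  qed
qed

end

theory Submission
  imports Defs "HOL-Combinatorics.Multiset_Permutations"
begin

text \<open>
  In the restricted growth function of a partition with \<open>k\<close> blocks, a first occurrence of a letter
  contributes nothing to \<open>lb\<close>, and a repeated occurrence of \<open>v\<close> contributes at most
  \<open>k - v\<close>. Avoiding \<open>123\<close> means that no letter is repeated more than once, so the \<open>n - k\<close>
  repeated letters are distinct and \<open>lb\<close> is at most the sum of \<open>k - v\<close> over \<open>v \<le> n - k\<close>.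
  Equality forces the repeated letters to be \<open>1, \<dots>, n - k\<close>, all of them after the first
  occurrence of \<open>k\<close>, which leaves the words \<open>12\<dots>k\<close> followed by a permutation of \<open>[n - k]\<close>.
\<close>

section \<open>Restricted growth words and containment of \<open>123\<close>\<close>

text \<open>The intended image of \<open>rgf n\<close> on the avoiders. Restricted growth is
  expressed through prefixes: a letter may appear only once all smaller ones have. The last clause
  is avoidance of \<open>123\<close>, read as a bound on block sizes.\<close>

definition rgf_words :: "nat \<Rightarrow> nat \<Rightarrow> nat list set" where
  "rgf_words n k = {w. length w = n \<and> set w = {1..k} \<and>
     (\<forall>i<n. {1..w ! i} \<subseteq> set (take (Suc i) w)) \<and> (\<forall>v. card {i. i < n \<and> w ! i = v} \<le> 2)}"

text \<open>Positions are counted from 1 here, so that the fibres of a word of length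
  \<open>n\<close> are blocks of a partition of \<open>{1..n}\<close>.\<close>

definition fibre :: "nat list \<Rightarrow> nat \<Rightarrow> nat set" where
  "fibre w v = {i \<in> {1..length w}. w ! (i - 1) = v}"

definition repeats :: "nat list \<Rightarrow> nat set" where
  "repeats w = {j. j < length w \<and> w ! j \<in> set (take j w)}"

text \<open>Taking ranks cannot enlarge a set, so only a block with three elements can yield
  \<open>{1, 2, 3}\<close>. Conversely, restricting to three elements of one block removes all other
  blocks, and the ranks of these elements are 1, 2, 3.\<close>

lemma contains_123_iff:
  assumes "partition_on {1..n} \<pi>"
  shows "contains \<pi> {{1, 2, 3}} \<longleftrightarrow> (\<exists>B\<in>\<pi>. 3 \<le> card B)"
proof
  assume "contains \<pi> {{1, 2, 3}}"
  then obtain S where S: "standardize S (restriction \<pi> S) = {{1, 2, 3}}"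
    by (auto simp: contains_def)
  have "{1, 2, 3} \<in> standardize S (restriction \<pi> S)"
    unfolding S by simp
  then obtain C where C: "C \<in> restriction \<pi> S" "(\<lambda>x. card {y \<in> S. y \<le> x}) ` C = {1, 2, 3}"
    unfolding standardize_def by (metis (no_types, lifting) imageE)
  then obtain B where B: "B \<in> \<pi>" "C = B \<inter> S"
    by (auto simp: restriction_def)
  have fin: "finite B"
    using B(1) partition_onD1[OF assms] by (metis Sup_upper finite_atLeastAtMost finite_subset)
  have "3 = card ((\<lambda>x. card {y \<in> S. y \<le> x}) ` C)"
    unfolding C(2) by simp
  also have "\<dots> \<le> card C"
    using fin B(2) by (intro card_image_le) simp
  also have "\<dots> \<le> card B"
    using fin B(2) by (intro card_mono) auto
  finally show "\<exists>B\<in>\<pi>. 3 \<le> card B"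
    using B(1) by blast
next
  assume "\<exists>B\<in>\<pi>. 3 \<le> card B"
  then obtain B where B: "B \<in> \<pi>" "3 \<le> card B" by blast
  then obtain S where S: "S \<subseteq> B" "card S = 3"
    by (meson obtain_subset_with_card_n)
  have finS: "finite S" using S(2) by (metis card.infinite zero_neq_numeral)
  define xs where "xs = sorted_list_of_set S"
  have xs: "set xs = S" "sorted_wrt (<) xs" "length xs = 3"
    using finS S(2) by (auto simp: xs_def)
  obtain x y z where xyz: "xs = [x, y, z]"
    using xs(3) by (auto simp: numeral_3_eq_3 length_Suc_conv)
  have ord: "x < y" "y < z" and Sxyz: "S = {x, y, z}"
    using xs xyz by auto
  have "restriction \<pi> S = {S}"
  proof -
    have "C \<inter> S = {} \<or> C = B" if "C \<in> \<pi>" for C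
      using disjointD[OF partition_onD2[OF assms] that B(1)] S(1) by blast
    moreover have "B \<inter> S = S" "S \<noteq> {}" using S(1) Sxyz by auto
    ultimately show ?thesis using B(1) unfolding restriction_def by blast
  qed
  moreover have "{u \<in> S. u \<le> x} = {x}" "{u \<in> S. u \<le> y} = {x, y}" "{u \<in> S. u \<le> z} = {x, y, z}"
    using ord Sxyz by auto
  then have "(\<lambda>x. card {y \<in> S. y \<le> x}) ` S = {1, 2, 3}"
    using ord by (subst (2) Sxyz) (simp add: numeral_2_eq_2 numeral_3_eq_3)
  ultimately have "standardize S (restriction \<pi> S) = {{1, 2, 3}}"
    by (simp add: standardize_def)
  moreover have "S \<subseteq> \<Union>\<pi>" using S(1) B(1) by blast
  ultimately show "contains \<pi> {{1, 2, 3}}"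
    unfolding contains_def by blast
qed

section \<open>The bijection between avoiders and words\<close>

lemma card_fibre: "card (fibre w v) = card {i. i < length w \<and> w ! i = v}"
proof -
  have "fibre w v = Suc ` {i. i < length w \<and> w ! i = v}"
  proof (intro equalityI subsetI)
    fix i assume "i \<in> fibre w v"
    then show "i \<in> Suc ` {i. i < length w \<and> w ! i = v}"
      by (intro image_eqI[of _ _ "i - 1"]) (auto simp: fibre_def)
  qed (auto simp: fibre_def)
  then show ?thesis by (simp add: card_image)
qed

lemma length_blocks:
  assumes "partition_on {1..n} \<pi>"
  shows "length (blocks \<pi>) = card \<pi>"
  using distinct_card[OF distinct_blocks[OF assms]] set_blocks[OF assms] by simp

lemma length_rgf [simp]: "length (rgf n \<pi>) = n"
  by (simp add: rgf_def)

text \<open>Existence and uniqueness of the letter turn the definite description in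
  \<open>rgf\<close> into an equivalence; later proofs use only this form.\<close>

lemma rgf_nth_iff:
  assumes "partition_on {1..n} \<pi>" "i \<in> {1..n}"
  shows "rgf n \<pi> ! (i - 1) = j \<longleftrightarrow> 1 \<le> j \<and> j \<le> card \<pi> \<and> i \<in> blocks \<pi> ! (j - 1)"
proof -
  have "i - 1 < length [1..<Suc n]" "[1..<Suc n] ! (i - 1) = i"
    using assms(2) by (auto simp del: upt_Suc)
  then have "rgf n \<pi> ! (i - 1) = (THE j. 1 \<le> j \<and> j \<le> card \<pi> \<and> i \<in> blocks \<pi> ! (j - 1))"
    unfolding rgf_def by (metis (no_types, lifting) nth_map)
  then show ?thesis
    using theI'[OF letter_ex1[OF assms]] the1_equality[OF letter_ex1[OF assms]] by metis
qed

lemma fibre_rgf: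
  assumes "partition_on {1..n} \<pi>" "v \<in> {1..card \<pi>}"
  shows "fibre (rgf n \<pi>) v = blocks \<pi> ! (v - 1)"
proof -
  have "blocks \<pi> ! (v - 1) \<in> \<pi>"
    using assms nth_mem[of "v - 1" "blocks \<pi>"] by (auto simp: length_blocks set_blocks)
  then have "blocks \<pi> ! (v - 1) \<subseteq> {1..n}"
    using partition_onD1[OF assms(1)] by blast
  then have "i \<in> fibre (rgf n \<pi>) v \<longleftrightarrow> i \<in> blocks \<pi> ! (v - 1)" for i
    using assms(2) rgf_nth_iff[OF assms(1), of i v] by (auto simp: fibre_def)
  then show ?thesis by blast
qed

text \<open>A partition is recovered from its word as the set of fibres, which gives injectivity of
  \<open>rgf n\<close>.\<close>

lemma fibres_rgf:
  assumes "partition_on {1..n} \<pi>"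
  shows "fibre (rgf n \<pi>) ` {1..card \<pi>} = \<pi>"
proof -
  have "fibre (rgf n \<pi>) ` {1..card \<pi>} = (\<lambda>v. blocks \<pi> ! (v - 1)) ` {1..card \<pi>}"
    by (intro image_cong refl) (rule fibre_rgf[OF assms])
  also have "\<dots> = (!) (blocks \<pi>) ` ((\<lambda>v. v - 1) ` {1..card \<pi>})"
    by (simp add: image_image)
  also have "(\<lambda>v. v - 1) ` {1..card \<pi>} = {..<card \<pi>}"
    by (force intro: image_eqI[where x = "Suc _"])
  also have "(!) (blocks \<pi>) ` {..<card \<pi>} = set (blocks \<pi>)"
    by (auto simp: set_conv_nth length_blocks[OF assms])
  finally show ?thesis by (simp add: set_blocks[OF assms])
qed

lemma rgf_in_rgf_words:
  assumes "\<pi> \<in> avoiders n k {{1, 2, 3}}"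
  shows "rgf n \<pi> \<in> rgf_words n k"
proof -
  have part: "partition_on {1..n} \<pi>" and k: "card \<pi> = k"
    and av: "\<not> contains \<pi> {{1, 2, 3}}"
    using assms by (auto simp: avoiders_def)
  let ?w = "rgf n \<pi>"
  have block: "blocks \<pi> ! (v - 1) \<in> \<pi>" if "v \<in> {1..k}" for v
    using that part nth_mem[of "v - 1" "blocks \<pi>"] k by (auto simp: length_blocks set_blocks)
  have block_fin: "finite B" "B \<noteq> {}" "B \<subseteq> {1..n}" if "B \<in> \<pi>" for B
    using that partition_onD1[OF part] partition_onD3[OF part]
    by (metis Sup_upper finite_atLeastAtMost finite_subset, metis, blast)
  have range: "?w ! i \<in> {1..k}" if "i < n" for i
    using rgf_nth_iff[OF part, of "Suc i"] that k by force
  have Min_letter: "Min (blocks \<pi> ! (v - 1)) \<in> {1..n}"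
    "?w ! (Min (blocks \<pi> ! (v - 1)) - 1) = v" if "v \<in> {1..k}" for v
  proof -
    have "Min (blocks \<pi> ! (v - 1)) \<in> blocks \<pi> ! (v - 1)"
      using block_fin[OF block[OF that]] by simp
    moreover from this show "Min (blocks \<pi> ! (v - 1)) \<in> {1..n}"
      using block_fin(3)[OF block[OF that]] by blast
    ultimately show "?w ! (Min (blocks \<pi> ! (v - 1)) - 1) = v"
      using rgf_nth_iff[OF part] that k by auto
  qed
  have "set ?w = {1..k}"
  proof (intro equalityI subsetI)
    fix v assume "v \<in> {1..k}"
    from Min_letter[OF this] show "v \<in> set ?w"
      by (metis One_nat_def Suc_pred atLeastAtMost_iff less_Suc_eq_le less_eq_Suc_le length_rgf nth_mem)
  qed (use range in \<open>auto simp: in_set_conv_nth\<close>)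
  \<comment> \<open>Blocks are listed by increasing minima. So the minimum of block \<open>v\<close>
    is at most that of block \<open>?w ! i\<close>, which is at most \<open>Suc i\<close>, and the
    letter at that minimum is \<open>v\<close>.\<close>
  moreover have "{1..?w ! i} \<subseteq> set (take (Suc i) ?w)" if "i < n" for i
  proof
    fix v assume v: "v \<in> {1..?w ! i}"
    have vk: "v \<in> {1..k}" using v range[OF that] by auto
    have "Suc i \<in> blocks \<pi> ! (?w ! i - 1)"
      using rgf_nth_iff[OF part, of "Suc i"] that by force
    then have "Min (blocks \<pi> ! (?w ! i - 1)) \<le> Suc i"
      using block_fin[OF block[OF range[OF that]]] by simp
    moreover have "Min (blocks \<pi> ! (v - 1)) \<le> Min (blocks \<pi> ! (?w ! i - 1))"
    proof (cases "v = ?w ! i")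
      case False
      then have "v - 1 < ?w ! i - 1" "?w ! i - 1 < length (blocks \<pi>)"
        using v range[OF that] k by (auto simp: length_blocks[OF part])
      then show ?thesis
        using sorted_blocks[OF part] by (simp add: sorted_wrt_iff_nth_less less_imp_le)
    qed simp
    ultimately have "Min (blocks \<pi> ! (v - 1)) - 1 < Suc i"
      using Min_letter(1)[OF vk] by auto
    then show "v \<in> set (take (Suc i) ?w)"
      using Min_letter(2)[OF vk] that unfolding in_set_conv_nth
      by (intro exI[of _ "Min (blocks \<pi> ! (v - 1)) - 1"]) auto
  qed
  moreover have "card {i. i < n \<and> ?w ! i = v} \<le> 2" for v
  proof (cases "v \<in> {1..k}")
    case True
    have "fibre ?w v \<in> \<pi>"
      using block[OF True] fibre_rgf[OF part, of v] True k by simp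
    then have "card (fibre ?w v) \<le> 2"
      using av unfolding contains_123_iff[OF part] by force
    then show ?thesis by (simp add: card_fibre)
  next
    case False
    then have "{i. i < n \<and> ?w ! i = v} = {}" using range by blast
    then show ?thesis by (metis card.empty zero_le)
  qed
  ultimately show ?thesis by (simp add: rgf_words_def)
qed

lemma rgf_words_prefixD:
  assumes "w \<in> rgf_words n k" "j < n" "v \<in> {1..w ! j}"
  obtains i where "i \<le> j" "w ! i = v"
proof -
  have "{1..w ! j} \<subseteq> set (take (Suc j) w)"
    using assms(1,2) unfolding rgf_words_def by blast
  then have "v \<in> set (take (Suc j) w)"
    using assms(3) by blast
  then obtain i where "i < length (take (Suc j) w)" "take (Suc j) w ! i = v"
    unfolding in_set_conv_nth by blast
  then show ?thesis
    using that[of i] by simp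
qed

text \<open>The fibres of a word form the partition it comes from. The prefix condition orders the
  minima of the fibres by their letters, so block number \<open>v\<close> is the fibre of
  \<open>v\<close>.\<close>

lemma rgf_surj:
  assumes w: "w \<in> rgf_words n k"
  shows "fibre w ` {1..k} \<in> avoiders n k {{1, 2, 3}}" and "rgf n (fibre w ` {1..k}) = w"
proof -
  let ?\<pi> = "fibre w ` {1..k}"
  have len: "length w = n" and set: "set w = {1..k}"
    and two: "card (fibre w v) \<le> 2" for v
    using w by (auto simp: rgf_words_def card_fibre)
  have ne: "fibre w v \<noteq> {}" if "v \<in> {1..k}" for v
  proof -
    from that obtain i where "i < n" "w ! i = v"
      using set len by (metis in_set_conv_nth)
    then have "Suc i \<in> fibre w v" by (simp add: fibre_def len)
    then show ?thesis by blast
  qed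
  have fin: "finite (fibre w v)" for v by (simp add: fibre_def)
  have inj: "inj_on (fibre w) {1..k}"
    by (rule inj_onI) (use ne in \<open>force simp: fibre_def\<close>)
  have letter: "w ! (i - 1) \<in> {1..k}" if "i \<in> {1..n}" for i
    using that set len nth_mem[of "i - 1" w] by auto
  have part: "partition_on {1..n} ?\<pi>"
  proof (rule partition_onI)
    show "\<Union>?\<pi> = {1..n}"
      using letter by (fastforce simp: fibre_def len)
    show "disjnt p q" if "p \<in> ?\<pi>" "q \<in> ?\<pi>" "p \<noteq> q" for p q
      using that by (auto simp: fibre_def disjnt_def)
    show "{} \<notin> ?\<pi>" using ne by force
  qed
  moreover have card: "card ?\<pi> = k" using card_image[OF inj] by simp
  moreover have "\<not> contains ?\<pi> {{1, 2, 3}}"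
    unfolding contains_123_iff[OF part] using two by (auto simp: not_le less_eq_Suc_le numeral_3_eq_3 numeral_2_eq_2)
  ultimately show "?\<pi> \<in> avoiders n k {{1, 2, 3}}"
    by (simp add: avoiders_def)
  \<comment> \<open>By the prefix condition \<open>u\<close> occurs no later than the first
    \<open>v\<close>, and not at the same position because the letters differ.\<close>
  have Min_less: "Min (fibre w u) < Min (fibre w v)" if "u < v" "u \<in> {1..k}" "v \<in> {1..k}" for u v
  proof -
    have m: "Min (fibre w v) \<in> fibre w v" using ne[OF that(3)] fin by simp
    let ?m = "Min (fibre w v)"
    have "?m - 1 < n" "u \<in> {1..w ! (?m - 1)}"
      using m that by (auto simp: fibre_def len)
    with w obtain i where i: "i \<le> ?m - 1" "w ! i = u"
      by (rule rgf_words_prefixD)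
    have "Suc i \<in> fibre w u" using i m by (auto simp: fibre_def)
    then have "Min (fibre w u) \<le> Suc i" using fin by simp
    moreover have "i \<noteq> ?m - 1" using i m that(1) by (auto simp: fibre_def)
    ultimately show ?thesis using i by linarith
  qed
  have "sorted_wrt (\<lambda>B C. Min B < Min C) (map (fibre w) [1..<Suc k])"
    unfolding sorted_wrt_map
    by (rule sorted_wrt_mono_rel[of _ "(<)"]) (use Min_less in \<open>auto simp del: upt_Suc\<close>)
  \<comment> \<open>The listing of the blocks by minima is unique, so exhibiting one such list
    determines \<open>blocks\<close>.\<close>
  then have blocks: "blocks ?\<pi> = map (fibre w) [1..<Suc k]"
    unfolding blocks_def
    by (intro the1_equality[OF blocks_ex1[OF part]] conjI)
      (auto simp: atLeastLessThanSuc_atLeastAtMost simp del: upt_Suc)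
  show "rgf n ?\<pi> = w"
  proof (rule nth_equalityI)
    fix i assume "i < length (rgf n ?\<pi>)"
    then have i: "Suc i \<in> {1..n}" by simp
    have v: "w ! i \<in> {1..k}" using letter[OF i] by simp
    have "w ! i - 1 < length [1..<Suc k]" "[1..<Suc k] ! (w ! i - 1) = w ! i"
      using v by (auto simp del: upt_Suc)
    then have "blocks ?\<pi> ! (w ! i - 1) = fibre w (w ! i)"
      unfolding blocks by (simp only: nth_map)
    moreover have "Suc i \<in> fibre w (w ! i)" using i by (simp add: fibre_def len)
    ultimately have "rgf n ?\<pi> ! (Suc i - 1) = w ! i"
      using v unfolding rgf_nth_iff[OF part i] card by auto
    then show "rgf n ?\<pi> ! i = w ! i" by simp
  qed (simp add: len)
qed

lemma bij_betw_rgf: "bij_betw (rgf n) (avoiders n k {{1, 2, 3}}) (rgf_words n k)"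
  unfolding bij_betw_def
proof
  show "inj_on (rgf n) (avoiders n k {{1, 2, 3}})"
  proof (rule inj_onI)
    fix \<pi> \<rho> assume "\<pi> \<in> avoiders n k {{1, 2, 3}}" "\<rho> \<in> avoiders n k {{1, 2, 3}}" "rgf n \<pi> = rgf n \<rho>"
    then show "\<pi> = \<rho>"
      using fibres_rgf[of n \<pi>] fibres_rgf[of n \<rho>] by (simp add: avoiders_def)
  qed
  show "rgf n ` avoiders n k {{1, 2, 3}} = rgf_words n k"
    using rgf_in_rgf_words rgf_surj by (force intro: image_eqI[OF sym])
qed

section \<open>Repeated letters and their contribution to \<open>lb\<close>\<close>

text \<open>First occurrences correspond one to one to the distinct letters; the repeats are the
  remaining positions.\<close>

lemma card_repeats: "card (repeats w) = length w - card (set w)"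
proof -
  let ?F = "{j. j < length w \<and> w ! j \<notin> set (take j w)}"
  have inj: "inj_on ((!) w) ?F"
  proof (rule linorder_inj_onI')
    fix i j assume "i \<in> ?F" "j \<in> ?F" "i < j"
    then show "w ! i \<noteq> w ! j" by (fastforce simp: in_set_conv_nth)
  qed
  have "(!) w ` ?F = set w"
  proof (intro equalityI subsetI)
    fix v assume "v \<in> set w"
    then have ex: "\<exists>i. i < length w \<and> w ! i = v" by (simp add: in_set_conv_nth)
    define j where "j = (LEAST i. i < length w \<and> w ! i = v)"
    have j: "j < length w" "w ! j = v" using LeastI_ex[OF ex] by (auto simp: j_def)
    have "w ! i \<noteq> v" if "i < j" for i
      using not_less_Least[of i "\<lambda>i. i < length w \<and> w ! i = v"] that j by (auto simp: j_def)
    then have "j \<in> ?F" using j by (auto simp: in_set_conv_nth)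
    then show "v \<in> (!) w ` ?F" using j by blast
  qed auto
  then have "card ?F = card (set w)" using card_image[OF inj] by simp
  moreover have "repeats w = {..<length w} - ?F" by (auto simp: repeats_def)
  moreover have "card ({..<length w} - ?F) = length w - card ?F"
    by (subst card_Diff_subset) auto
  ultimately show ?thesis by simp
qed

text \<open>Two repeats of the same letter, together with an occurrence before the earlier one,
  would be three occurrences.\<close>

lemma inj_on_repeats:
  assumes "w \<in> rgf_words n k"
  shows "inj_on ((!) w) (repeats w)"
proof (rule linorder_inj_onI')
  fix i j assume ij: "i \<in> repeats w" "j \<in> repeats w" "i < j"
  then obtain h where h: "h < i" "w ! h = w ! i"
    by (auto simp: repeats_def in_set_conv_nth)
  have len: "length w = n" and two: "card {i. i < n \<and> w ! i = v} \<le> 2" for v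
    using assms by (auto simp: rgf_words_def)
  show "w ! i \<noteq> w ! j"
  proof
    assume eq: "w ! i = w ! j"
    have "card {h, i, j} \<le> card {l. l < n \<and> w ! l = w ! i}"
      by (rule card_mono) (use h ij eq len in \<open>auto simp: repeats_def\<close>)
    then show False using two[of "w ! i"] h(1) ij(3) by simp
  qed
qed

text \<open>A larger letter before position \<open>j\<close> would, by the prefix condition, have
  been preceded by the letter \<open>w ! j\<close>, making \<open>j\<close> a repeat.\<close>

lemma lb_letter_first:
  assumes "w \<in> rgf_words n k" "j < n" "j \<notin> repeats w"
  shows "lb_letter w j = 0"
proof -
  have w: "length w = n" "set w = {1..k}" using assms(1) by (auto simp: rgf_words_def)
  have "w ! i \<le> w ! j" if "i < j" for i
  proof (rule ccontr)
    assume "\<not> w ! i \<le> w ! j"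
    moreover have "w ! j \<in> {1..k}" using w assms(2) nth_mem by blast
    ultimately have "w ! j \<in> {1..w ! i}" by simp
    moreover have "i < n" using that assms(2) by simp
    ultimately obtain h where "h \<le> i" "w ! h = w ! j"
      using rgf_words_prefixD[OF assms(1)] by metis
    then have "w ! j \<in> set (take j w)"
      using that assms(2) w unfolding in_set_conv_nth by (intro exI[of _ h]) auto
    then show False using assms(2,3) w by (simp add: repeats_def)
  qed
  then have "{w ! i | i. i < j \<and> w ! i > w ! j} = {}" by force
  then show ?thesis unfolding lb_letter_def by (metis card.empty)
qed

text \<open>The values counted by \<open>lb_letter\<close> lie in \<open>{w ! j<..k}\<close>, which
  has \<open>k - w ! j\<close> elements; equality of cardinalities means that all of them have been
  seen.\<close>

lemma lb_letter_le:
  assumes "set w \<subseteq> {1..k}" "j < length w"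
  shows "lb_letter w j \<le> k - w ! j"
    and "lb_letter w j = k - w ! j \<longleftrightarrow> {w ! j<..k} \<subseteq> set (take j w)"
proof -
  let ?A = "{w ! i | i. i < j \<and> w ! i > w ! j}"
  have A: "?A = set (take j w) \<inter> {w ! j<..}"
    using assms(2) by (fastforce simp: in_set_conv_nth)
  have sub: "?A \<subseteq> {w ! j<..k}"
  proof -
    have "set (take j w) \<subseteq> {1..k}" using assms(1) set_take_subset by (rule order_trans[rotated])
    then show ?thesis unfolding A by auto
  qed
  show "lb_letter w j \<le> k - w ! j"
    using card_mono[OF _ sub] by (simp add: lb_letter_def)
  have "lb_letter w j = k - w ! j \<longleftrightarrow> ?A = {w ! j<..k}"
    using card_subset_eq[OF _ sub] by (auto simp: lb_letter_def)
  also have "\<dots> \<longleftrightarrow> {w ! j<..k} \<subseteq> set (take j w)"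
  proof -
    have "{w ! j<..k} \<subseteq> {w ! j<..}" by auto
    then show ?thesis using sub unfolding A by blast
  qed
  finally show "lb_letter w j = k - w ! j \<longleftrightarrow> {w ! j<..k} \<subseteq> set (take j w)" .
qed

section \<open>Extremal sums over sets of positive integers\<close>

text \<open>Exchange \<open>V - {1..card V}\<close> for the equally large
  \<open>{1..card V} - V\<close>: every element removed exceeds \<open>card V\<close>, every element
  inserted does not, so each exchange lowers the sum by at least 1. The extra summand records this
  gain and settles the case of equality.\<close>

lemma sum_ge_initial_segment:
  fixes V :: "nat set"
  assumes "finite V" "0 \<notin> V"
  shows "\<Sum>{1..card V} + card (V - {1..card V}) \<le> \<Sum>V"
proof -
  let ?I = "{1..card V}"
  have card: "card (V - ?I) = card (?I - V)"
    using assms(1) card_Int_Diff[of V ?I] card_Int_Diff[of ?I V]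
    by (simp add: Int_commute)
  have "(\<Sum>v\<in>?I - V. v) \<le> card V * card (?I - V)"
    using sum_bounded_above[of "?I - V" "\<lambda>v. v" "card V"] by (simp add: mult.commute)
  moreover have "Suc (card V) * card (V - ?I) \<le> (\<Sum>v\<in>V - ?I. v)"
    using sum_bounded_below[of "V - ?I" "Suc (card V)" "\<lambda>v. v"] assms
    by (force simp: mult.commute not_le Suc_le_eq)
  moreover have "\<Sum>V = \<Sum>(V - ?I) + \<Sum>(V \<inter> ?I)"
    using sum.Int_Diff[OF assms(1), of "\<lambda>v. v" ?I] by simp
  moreover have "\<Sum>?I = \<Sum>(?I - V) + \<Sum>(V \<inter> ?I)"
    using sum.Int_Diff[of ?I "\<lambda>v. v" V] by (simp add: Int_commute)
  ultimately show ?thesis using card by simp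
qed

lemma sum_diff_le_initial_segment:
  assumes "V \<subseteq> {1..k}"
  shows "(\<Sum>v\<in>V. k - v) \<le> (\<Sum>v=1..card V. k - v)"
    and "(\<Sum>v\<in>V. k - v) = (\<Sum>v=1..card V. k - v) \<Longrightarrow> V = {1..card V}"
proof -
  have fin: "finite V" using assms finite_subset by blast
  have le: "card V \<le> k" using card_mono[OF _ assms] by simp
  \<comment> \<open>Adding back the subtracted terms avoids truncated subtraction. Both sums are
    thus complements to \<open>k * card V\<close>, and the lower bound on \<open>\<Sum>V\<close>
    becomes an upper bound.\<close>
  have "(\<Sum>v\<in>V. k - v) + \<Sum>V = k * card V"
    using assms by (subst sum.distrib[symmetric]) (subst sum.cong[where h = "\<lambda>_. k"], auto)
  moreover have "(\<Sum>v=1..card V. k - v) + \<Sum>{1..card V} = k * card V"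
    using le by (subst sum.distrib[symmetric]) (subst sum.cong[where h = "\<lambda>_. k"], auto)
  moreover have "0 \<notin> V" using assms by auto
  note sum_ge_initial_segment[OF fin this]
  ultimately have ineq: "(\<Sum>v\<in>V. k - v) + card (V - {1..card V}) \<le> (\<Sum>v=1..card V. k - v)"
    by linarith
  then show "(\<Sum>v\<in>V. k - v) \<le> (\<Sum>v=1..card V. k - v)" by linarith
  assume "(\<Sum>v\<in>V. k - v) = (\<Sum>v=1..card V. k - v)"
  with ineq have "card (V - {1..card V}) = 0" by linarith
  then have "V \<subseteq> {1..card V}" using fin by simp
  then show "V = {1..card V}" by (intro card_subset_eq) auto
qed

section \<open>The upper bound for \<open>lb\<close> and the case of equality\<close>

lemma lb_word_repeats:
  assumes "w \<in> rgf_words n k"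
  shows "lb_word w = (\<Sum>j\<in>repeats w. lb_letter w j)"
proof -
  have "length w = n" using assms by (simp add: rgf_words_def)
  then show ?thesis
    unfolding lb_word_def
    using lb_letter_first[OF assms]
    by (intro sum.mono_neutral_right) (auto simp: repeats_def)
qed

text \<open>Two estimates are chained: each repeat of \<open>v\<close> contributes at most
  \<open>k - v\<close>, and the repeated letters form a set of size \<open>n - k\<close>. Equality
  makes both tight: every repeat has seen all larger letters, and the repeated letters are exactly
  \<open>{1..n - k}\<close>.\<close>

lemma lb_word_le:
  assumes w: "w \<in> rgf_words n k"
  shows "lb_word w \<le> (\<Sum>v=1..n - k. k - v)"
    and "lb_word w = (\<Sum>v=1..n - k. k - v) \<Longrightarrow>
      (\<exists>u\<in>permutations_of_set {1..n - k}. w = [1..<Suc k] @ u)"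
proof -
  let ?R = "repeats w"
  let ?V = "(!) w ` ?R"
  have len: "length w = n" and set: "set w = {1..k}" using w by (auto simp: rgf_words_def)
  have finR: "finite ?R" by (simp add: repeats_def)
  have inj: "inj_on ((!) w) ?R" by (rule inj_on_repeats[OF w])
  have card: "card ?R = n - k" by (simp add: card_repeats len set)
  have cardV: "card ?V = n - k" using card_image[OF inj] card by simp
  have V: "?V \<subseteq> {1..k}"
    unfolding set[symmetric] by (auto simp: repeats_def)
  have letter: "lb_letter w j \<le> k - w ! j" if "j \<in> ?R" for j
    using that lb_letter_le(1)[of w k j] set by (auto simp: repeats_def)
  have "lb_word w = (\<Sum>j\<in>?R. lb_letter w j)" by (rule lb_word_repeats[OF w])
  also have le1: "\<dots> \<le> (\<Sum>j\<in>?R. k - w ! j)" using letter by (rule sum_mono)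
  also have "\<dots> = (\<Sum>v\<in>?V. k - v)" using inj by (simp add: sum.reindex)
  also have le2: "\<dots> \<le> (\<Sum>v=1..n - k. k - v)"
    using sum_diff_le_initial_segment(1)[OF V] cardV by simp
  finally show "lb_word w \<le> (\<Sum>v=1..n - k. k - v)" .
  assume eq: "lb_word w = (\<Sum>v=1..n - k. k - v)"
  have VI: "?V = {1..n - k}"
    using sum_diff_le_initial_segment(2)[OF V] cardV le1 le2 eq lb_word_repeats[OF w] inj
    by (simp add: sum.reindex)
  have "(\<Sum>j\<in>?R. lb_letter w j) = (\<Sum>j\<in>?R. k - w ! j)"
    using le1 le2 eq lb_word_repeats[OF w] inj by (simp add: sum.reindex)
  then have tight: "lb_letter w j = k - w ! j" if "j \<in> ?R" for j
    using sum_mono_inv[of "lb_letter w" ?R "\<lambda>j. k - w ! j", OF _ letter that finR] by simp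
  \<comment> \<open>Before a repeat \<open>j\<close> the letter \<open>k\<close> has occurred: by
    tightness if \<open>w ! j < k\<close>, and because \<open>j\<close> is a repeat if
    \<open>w ! j = k\<close>.\<close>
  have "k \<le> j" if j: "j \<in> ?R" for j
  proof (cases k)
    case (Suc k')
    have jn: "j < n" "w ! j \<in> set (take j w)" using j len by (auto simp: repeats_def)
    have "w ! j \<in> {1..k}" using set len jn nth_mem by blast
    then have "k \<in> set (take j w)"
      using tight[OF j] lb_letter_le(2)[of w k j] set jn len by (cases "w ! j = k") auto
    then obtain i where i: "i < j" "w ! i = k" by (auto simp: in_set_conv_nth)
    have "i < n" using i jn by simp
    then have "{1..w ! i} \<subseteq> set (take (Suc i) w)"
      using w unfolding rgf_words_def by blast
    \<comment> \<open>The prefix through an occurrence of \<open>k\<close> contains all of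
      \<open>{1..k}\<close>, so it has at least \<open>k\<close> positions:
      \<open>k \<le> Suc i \<le> j\<close>.\<close>
    then have "k \<le> card (set (take (Suc i) w))"
      using card_mono[of "set (take (Suc i) w)" "{1..k}"] i(2) by simp
    also have "\<dots> \<le> Suc i" using card_length[of "take (Suc i) w"] by simp
    finally show ?thesis using i by simp
  qed simp
  then have "?R \<subseteq> {k..<n}" using len by (auto simp: repeats_def)
  then have R: "?R = {k..<n}" using card by (intro card_subset_eq) auto
  have kn: "k \<le> n" using card_length[of w] set len by simp
  \<comment> \<open>Strong induction: after the prefix \<open>1, \<dots>, i\<close> a letter that is
    not a repeat exceeds \<open>i\<close>, and one beyond \<open>Suc i\<close> would violate the
    prefix condition, since \<open>Suc i\<close> would be missing.\<close>
  have first: "w ! i = Suc i" if "i < k" for i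
    using that
  proof (induction i rule: less_induct)
    case (less i)
    have "take i w = [1..<Suc i]"
      using less kn len by (intro nth_equalityI) (auto simp del: upt_Suc)
    then have tk: "set (take i w) = {1..i}" by auto
    have "i \<notin> ?R" using R less by simp
    then have "w ! i \<notin> {1..i}" using tk less kn len by (simp add: repeats_def)
    moreover have "w ! i \<in> {1..k}" using set len less kn nth_mem[of i w] by auto
    moreover have "\<not> Suc i < w ! i"
    proof
      assume "Suc i < w ! i"
      moreover have "{1..w ! i} \<subseteq> set (take (Suc i) w)"
        using w less kn unfolding rgf_words_def by simp
      ultimately have "Suc i \<in> set (take (Suc i) w)" by auto
      then show False
        using tk \<open>Suc i < w ! i\<close> less kn len by (simp add: take_Suc_conv_app_nth)
    qed
    ultimately show ?case by auto
  qed
  have "take k w = [1..<Suc k]"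
    using first kn len by (intro nth_equalityI) (auto simp del: upt_Suc)
  then have split: "w = [1..<Suc k] @ drop k w" by (metis append_take_drop_id)
  have "drop k w = map ((!) w) [k..<n]"
    using kn len by (intro nth_equalityI) auto
  then have "set (drop k w) = (!) w ` {k..<n}" by simp
  then have dset: "set (drop k w) = {1..n - k}" using VI R by simp
  then have "distinct (drop k w)" by (intro card_distinct) (simp add: len)
  with dset split show "\<exists>u\<in>permutations_of_set {1..n - k}. w = [1..<Suc k] @ u"
    by (intro bexI[of _ "drop k w"]) (simp_all add: permutations_of_set_def del: upt_Suc)
qed

section \<open>The words attaining the bound\<close>

text \<open>From \<open>n \<le> 2 * k\<close> follows \<open>n - k \<le> k\<close>, so the letters
  of \<open>u\<close> are among \<open>1, \<dots>, k\<close>. Each of them comes after all of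
  \<open>{1..k}\<close> and therefore contributes the full \<open>k - v\<close>.\<close>

lemma maximal_word:
  assumes u: "u \<in> permutations_of_set {1..n - k}" and kn: "k \<le> n" and nk: "n \<le> 2 * k"
  defines "w \<equiv> [1..<Suc k] @ u"
  shows "w \<in> rgf_words n k" and "lb_word w = (\<Sum>v=1..n - k. k - v)"
proof -
  have su: "set u = {1..n - k}" and du: "distinct u" using u by (auto simp: permutations_of_set_def)
  have lu: "length u = n - k" using distinct_card[OF du] su by simp
  have len: "length w = n" using lu kn by (simp add: w_def del: upt_Suc)
  have low: "w ! i = Suc i" if "i < k" for i using that by (simp add: w_def nth_append del: upt_Suc)
  have high: "w ! i = u ! (i - k)" if "k \<le> i" for i using that by (simp add: w_def nth_append del: upt_Suc)
  have set: "set w = {1..k}" using su nk by (auto simp: w_def simp del: upt_Suc)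
  have tk: "set (take i w) = {1..i}" if "i \<le> k" for i
    using that by (auto simp: w_def simp del: upt_Suc)
  have tk': "set (take i w) = {1..k}" if "k \<le> i" for i
    using set set_take_subset[of i w] set_take_subset_set_take[OF that, of w] tk[OF order_refl]
    by (metis subset_antisym)
  have "{1..w ! i} \<subseteq> set (take (Suc i) w)" if "i < n" for i
  proof (cases "i < k")
    case True
    then show ?thesis using low tk[of "Suc i"] by auto
  next
    case False
    then have "set (take (Suc i) w) = {1..k}" by (intro tk') simp
    moreover have "w ! i \<le> k" using set that len nth_mem[of i w] by auto
    ultimately show ?thesis by simp
  qed
  moreover have "card {i. i < n \<and> w ! i = v} \<le> 2" for v
  proof -
    \<comment> \<open>Each value occurs at most once in the increasing part and at most once in the
      permutation; the two sets separate these positions.\<close>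
    let ?A = "{i. i < k \<and> Suc i = v}" and ?B = "(+) k ` {i. i < n - k \<and> u ! i = v}"
    have sub: "{i. i < n \<and> w ! i = v} \<subseteq> ?A \<union> ?B"
    proof
      fix i assume i: "i \<in> {i. i < n \<and> w ! i = v}"
      show "i \<in> ?A \<union> ?B"
        using i low high by (cases "i < k") (auto intro!: image_eqI[of _ _ "i - k"])
    qed
    have "card {i. i < n \<and> w ! i = v} \<le> card (?A \<union> ?B)"
      by (rule card_mono[OF _ sub]) simp
    also have "\<dots> \<le> card ?A + card ?B" by (rule card_Un_le)
    also have "card ?A \<le> 1"
      by (intro card_le_Suc0_iff_eq[THEN iffD2, folded One_nat_def]) auto
    also have "card ?B \<le> 1"
      using du lu
      by (subst card_image) (auto intro!: card_le_Suc0_iff_eq[THEN iffD2] simp: nth_eq_iff_index_eq)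
    finally show ?thesis by simp
  qed
  ultimately show w: "w \<in> rgf_words n k" by (simp add: rgf_words_def len set)
  have "{k..<n} \<subseteq> repeats w"
    using tk' set len nth_mem[of _ w] by (auto simp: repeats_def)
  moreover have "card (repeats w) = n - k" by (simp add: card_repeats len set)
  moreover have "finite (repeats w)" by (simp add: repeats_def)
  ultimately have R: "repeats w = {k..<n}" using card_subset_eq[of "repeats w" "{k..<n}"] by simp
  have "lb_word w = (\<Sum>j=k..<n. lb_letter w j)" using lb_word_repeats[OF w] R by simp
  also have "\<dots> = (\<Sum>j=k..<n. k - w ! j)"
  proof (rule sum.cong)
    fix j assume j: "j \<in> {k..<n}"
    then have "{w ! j<..k} \<subseteq> set (take j w)" by (auto simp: tk')
    then show "lb_letter w j = k - w ! j"
      using lb_letter_le(2)[of w k j] j set len by simp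
  qed simp
  also have "\<dots> = (\<Sum>i<n - k. k - u ! i)"
    using kn by (intro sum.reindex_bij_witness[of _ "\<lambda>i. i + k" "\<lambda>j. j - k"]) (auto simp: high)
  \<comment> \<open>A permutation lists every \<open>v\<close> in \<open>{1..n - k}\<close> exactly
    once, so the order of \<open>u\<close> does not affect the sum.\<close>
  also have "\<dots> = (\<Sum>v=1..n - k. k - v)"
    using sum.reindex_bij_betw[OF bij_betw_nth[OF du refl su[symmetric]], of "\<lambda>v. k - v"] lu by simp
  finally show "lb_word w = (\<Sum>v=1..n - k. k - v)" .
qed

lemma card_maximal_words:
  assumes "k \<le> n" "n \<le> 2 * k"
  shows "card {w \<in> rgf_words n k. lb_word w = (\<Sum>v=1..n - k. k - v)} = fact (n - k)"
proof -
  have "{w \<in> rgf_words n k. lb_word w = (\<Sum>v=1..n - k. k - v)} =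
      (@) [1..<Suc k] ` permutations_of_set {1..n - k}"
    using lb_word_le(2) maximal_word[OF _ assms] by blast
  moreover have "inj_on ((@) [1..<Suc k]) (permutations_of_set {1..n - k})"
    by (rule inj_onI) (rule same_append_eq[THEN iffD1])
  ultimately show ?thesis by (simp only: card_image) simp
qed

section \<open>Degree and leading coefficient\<close>

text \<open>All monomials have coefficient 1, so nothing cancels: the coefficient at
  \<open>d\<close> counts the elements attaining the maximum.\<close>

lemma degree_lead_coeff_sum_monom:
  fixes f :: "'a \<Rightarrow> nat"
  assumes "finite A" "\<And>x. x \<in> A \<Longrightarrow> f x \<le> d" "\<exists>x\<in>A. f x = d"
  shows "degree (\<Sum>x\<in>A. monom (1 :: int) (f x)) = d"
    and "lead_coeff (\<Sum>x\<in>A. monom (1 :: int) (f x)) = int (card {x \<in> A. f x = d})"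
proof -
  let ?p = "\<Sum>x\<in>A. monom (1 :: int) (f x)"
  have coeff: "coeff ?p d = int (card {x \<in> A. f x = d})"
    using assms(1) by (simp add: coeff_sum sum.If_cases Int_def)
  have "{x \<in> A. f x = d} \<noteq> {}" using assms(3) by blast
  then have "coeff ?p d \<noteq> 0" using assms(1) coeff by simp
  moreover have "degree ?p \<le> d"
    using assms(2) by (intro degree_sum_le[OF assms(1)]) (simp add: degree_monom_eq)
  ultimately show deg: "degree ?p = d" using le_degree by (metis order_antisym)
  show "lead_coeff ?p = int (card {x \<in> A. f x = d})" using coeff deg by simp
qed

text \<open>The bound \<open>d \<le> k\<close> makes the natural differences agree with the real
  ones.\<close>

lemma real_sum_diff_upto:
  assumes "d \<le> k"
  shows "real (\<Sum>v=1..d. k - v) = real d * real k - real d * (real d + 1) / 2"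
  using assms by (induction d) (auto simp: field_simps)

theorem theorem6p2:
  fixes n k :: nat
  assumes "n \<ge> 1" and "\<lceil>real n / 2\<rceil> \<le> int k" and "k \<le> n"
  shows "real (degree (LB n k {{1, 2, 3}})) =
      ((4 * real n + 1) * real k - 3 * real k ^ 2 - real n ^ 2 - real n) / 2
    \<and> lead_coeff (LB n k {{1, 2, 3}}) = fact (n - k)"
proof -
  \<comment> \<open>The ceiling condition enters only in this form; it gives
    \<open>n - k \<le> k\<close>.\<close>
  have nk: "n \<le> 2 * k" using assms(2) by linarith
  let ?d = "\<Sum>v=1..n - k. k - v"
  have LB: "LB n k {{1, 2, 3}} = (\<Sum>w\<in>rgf_words n k. monom 1 (lb_word w))"
    unfolding LB_def lb_def by (rule sum.reindex_bij_betw[OF bij_betw_rgf])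
  have fin: "finite (rgf_words n k)"
    using bij_betw_finite[OF bij_betw_rgf] finite_avoiders by blast
  have card: "card {w \<in> rgf_words n k. lb_word w = ?d} = fact (n - k)"
    by (rule card_maximal_words[OF assms(3) nk])
  then have "{w \<in> rgf_words n k. lb_word w = ?d} \<noteq> {}"
    by (metis card.empty fact_nonzero)
  then have ex: "\<exists>w\<in>rgf_words n k. lb_word w = ?d" by blast
  \<comment> \<open>The closed form at \<open>d = n - k\<close>, expanded.\<close>
  have "real ?d = ((4 * real n + 1) * real k - 3 * real k ^ 2 - real n ^ 2 - real n) / 2"
    using assms(3) nk
    by (subst real_sum_diff_upto) (auto simp: field_simps power2_eq_square)
  then show ?thesis
    unfolding LB using degree_lead_coeff_sum_monom[OF fin lb_word_le(1) ex] card by simp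
qed

end
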